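(* Let $\mathcal A$ be a commutative ring and $D$ a derivation of $\mathcal A$. Then for all $f\in\mathcal A$ and $n\ge1$, $$\det\begin{pmatrix} f & f^2 & \cdots & f^n\\ D(f) & D(f^2) & \cdots & D(f^n)\\ D^2(f) & D^2(f^2) & \cdots & D^2(f^n)\\ \vdots & \vdots & & \vdots\\ D^{n-1}(f) & D^{n-1}(f^2) & \cdots & D^{n-1}(f^n)\end{pmatrix}=\alpha_n\,(Df)^{\frac12n(n-1)}f^n,$$ where $\alpha_n=\prod_{k=1}^{n-1}k!$.
   Context: A derivation of $\mathcal A$ is an additive map $D:\mathcal A\to\mathcal A$ with $D(ab)=D(a)b+aD(b)$ for all $a,b\in\mathcal A$. The matrix is $n\times n$ with $(i,j)$ entry $D^{i-1}(f^j)$, $1\le i,j\le n$; an empty product is $1$. *)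

theory Defs
  imports "Jordan_Normal_Form.Determinant"
begin

definition derivation :: "('a::comm_ring_1 \<Rightarrow> 'a) \<Rightarrow> bool" where
  "derivation D \<longleftrightarrow>
     (\<forall>a b. D (a + b) = D a + D b) \<and> (\<forall>a b. D (a * b) = D a * b + a * D b)"

end

theory Submission
  imports Defs
begin

text \<open>
  View multiplication by \<open>f\<close> as an operator and let \<open>ad f L = [L, f]\<close>.
  By induction on \<open>i\<close>, \<open>(ad f)^j (D^i)\<close> vanishes for \<open>j > i\<close> and is multiplication
  by \<open>i! (D f)^i\<close> for \<open>j = i\<close>. On the other hand \<open>(ad f)^j (D^i)\<close>, applied to \<open>f\<close>, is a linear
  combination of the entries \<open>D^i (f^(k+1))\<close>, \<open>k \<le> j\<close>, whose binomial coefficients do not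
  depend on \<open>i\<close> and equal \<open>1\<close> for \<open>k = j\<close>. Hence unipotent column operations turn the
  matrix into a lower triangular one with diagonal entries \<open>j! (D f)^j f\<close>.
\<close>

definition ad :: "'a::comm_ring_1 \<Rightarrow> ('a \<Rightarrow> 'a) \<Rightarrow> 'a \<Rightarrow> 'a" where
  "ad f L h = L (f * h) - f * L h"

lemma ad_funpow_Suc:
  "(ad f ^^ Suc j) L h = (ad f ^^ j) L (f * h) - f * (ad f ^^ j) L h"
  by (simp add: ad_def)

text \<open>\<open>ad f\<close> is the difference of two commuting operators on maps, precomposition
  and postcomposition with multiplication by \<open>f\<close>, so the binomial theorem
  applies.\<close>

lemma ad_funpow_expand:
  "(ad f ^^ j) L h = (\<Sum>k\<le>j. of_nat (j choose k) * (- f) ^ (j - k) * L (f ^ k * h))"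
proof (induction j arbitrary: h)
  case 0
  show ?case by simp
next
  case (Suc j)
  let ?g = "\<lambda>k. of_nat (j choose k) * (- f) ^ (j - k) * L (f ^ k * h)"
  \<comment> \<open>At \<open>k = j\<close> the term \<open>?g (Suc k)\<close> vanishes through its
    binomial coefficient; for \<open>k < j\<close> no subtraction is truncated.\<close>
  have pascal: "of_nat (Suc j choose Suc k) * (- f) ^ (Suc j - Suc k) * L (f ^ Suc k * h) =
      of_nat (j choose k) * (- f) ^ (j - k) * L (f ^ k * (f * h)) - f * ?g (Suc k)"
    if "k \<le> j" for k
  proof (cases "k = j")
    case True
    then show ?thesis by (simp add: ac_simps binomial_eq_0)
  next
    case False
    with that have "j - k = Suc (j - Suc k)" by simp
    then show ?thesis by (simp add: algebra_simps)
  qed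
  have "(\<Sum>k\<le>Suc j. of_nat (Suc j choose k) * (- f) ^ (Suc j - k) * L (f ^ k * h)) =
      - f * ?g 0 + (\<Sum>k\<le>j. of_nat (j choose k) * (- f) ^ (j - k) * L (f ^ k * (f * h)) - f * ?g (Suc k))"
    by (subst sum.atMost_Suc_shift, subst sum.cong[OF refl pascal]) auto
  also have "\<dots> = (ad f ^^ j) L (f * h) - f * (\<Sum>k\<le>Suc j. ?g k)"
    unfolding Suc.IH sum.atMost_Suc_shift[of ?g]
    by (simp add: sum_subtractf sum_distrib_left distrib_left)
  also have "(\<Sum>k\<le>Suc j. ?g k) = (ad f ^^ j) L h"
    by (simp add: Suc.IH binomial_eq_0)
  finally show ?case by (simp only: ad_funpow_Suc)
qed

lemma
  assumes "derivation D"
  shows derivation_add: "D (a + b) = D a + D b"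
    and derivation_mult: "D (a * b) = D a * b + a * D b"
  using assms unfolding derivation_def by auto

lemma derivation_0:
  assumes "derivation D"
  shows "D 0 = 0"
  using derivation_add[OF assms, of 0 0] by simp

lemma derivation_diff:
  assumes "derivation D"
  shows "D (a - b) = D a - D b"
  using derivation_add[OF assms, of "a - b" b] by (simp add: algebra_simps)

text \<open>The Leibniz rule for \<open>ad f\<close> on the composition \<open>D \<circ> L\<close>, since \<open>ad f D\<close> is
  multiplication by \<open>D f\<close>, which commutes with \<open>f\<close>.\<close>

lemma ad_funpow_derivation_comp:
  assumes "derivation D"
  shows "(ad f ^^ j) (D \<circ> L) h =
    D ((ad f ^^ j) L h) + of_nat j * D f * (ad f ^^ (j - 1)) L h"
proof (induction j arbitrary: h)
  case 0
  show ?case by simp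
next
  case (Suc j)
  \<comment> \<open>At \<open>j = 0\<close> the truncated index \<open>j - 1\<close> is harmless:
    the factor \<open>of_nat j\<close> is zero.\<close>
  have shift: "of_nat j * (ad f ^^ (j - 1)) L (f * h) =
      of_nat j * (f * (ad f ^^ (j - 1)) L h + (ad f ^^ j) L h)"
    by (cases j) (simp_all del: funpow.simps(2) add: ad_funpow_Suc)
  have "(ad f ^^ Suc j) (D \<circ> L) h = D ((ad f ^^ Suc j) L h) + D f * (ad f ^^ j) L h +
      D f * (of_nat j * (ad f ^^ (j - 1)) L (f * h) - of_nat j * (f * (ad f ^^ (j - 1)) L h))"
    unfolding ad_funpow_Suc Suc.IH derivation_diff[OF assms] derivation_mult[OF assms]
    by (simp add: algebra_simps)
  then show ?case
    unfolding shift by (simp del: funpow.simps(2) comp_apply add: algebra_simps)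
qed

lemma ad_funpow_derivation_funpow:
  assumes "derivation D" and "i \<le> j"
  shows "(ad f ^^ j) (D ^^ i) h = (if i = j then of_nat (fact i) * D f ^ i * h else 0)"
  using assms(2)
proof (induction i arbitrary: j)
  case 0
  have "(ad f ^^ Suc k) id h = 0" for k h
    by (induction k arbitrary: h) (simp_all add: ad_def)
  then show ?case by (cases j) (simp_all del: funpow.simps(2) add: id_def)
next
  case (Suc i)
  then obtain m where j: "j = Suc m" and m: "i \<le> m" by (cases j) auto
  \<comment> \<open>Since \<open>i < j\<close>, the induction hypothesis kills the summand under
    \<open>D\<close> in the Leibniz rule.\<close>
  have "(ad f ^^ j) (D ^^ Suc i) h = of_nat j * D f * (ad f ^^ m) (D ^^ i) h"
    using Suc.IH[of j] m j
    by (simp only: funpow.simps(2)[of _ D] ad_funpow_derivation_comp[OF assms(1)])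
      (simp del: funpow.simps(2) add: derivation_0[OF assms(1)])
  then show ?case using Suc.IH[OF m] j by (simp del: funpow.simps(2) add: algebra_simps)
qed

theorem proposition5p1:
  fixes D :: "'a::comm_ring_1 \<Rightarrow> 'a" and f :: 'a and n :: nat
  assumes "derivation D" and "n \<ge> 1"
  shows "det (mat n n (\<lambda>(i, j). (D ^^ i) (f ^ (j + 1)))) =
    of_nat (\<Prod>k = 1..n - 1. fact k) * (D f) ^ (n * (n - 1) div 2) * f ^ n"
proof -
  define M where "M = mat n n (\<lambda>(i, j). (D ^^ i) (f ^ (j + 1)))"
  define U where "U = mat n n (\<lambda>(k, j). of_nat (j choose k) * (- f) ^ (j - k))"
  define T where "T = mat n n (\<lambda>(i, j). (ad f ^^ j) (D ^^ i) f)"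
  have carrier: "M \<in> carrier_mat n n" "U \<in> carrier_mat n n" "T \<in> carrier_mat n n"
    by (simp_all add: M_def U_def T_def)
  have "det U = 1"
  proof -
    have "diag_mat U = replicate n 1"
      by (auto simp: U_def diag_mat_def intro: nth_equalityI)
    moreover have "upper_triangular U"
      by (auto simp: U_def binomial_eq_0)
    ultimately show ?thesis
      using det_upper_triangular[OF _ carrier(2)] by simp
  qed
  have "M * U = T"
  proof (rule eq_matI)
    fix i j assume "i < dim_row T" "j < dim_col T"
    then have i: "i < n" and j: "j < n" by (simp_all add: T_def)
    have "(M * U) $$ (i, j) =
        (\<Sum>k<n. (D ^^ i) (f ^ (k + 1)) * (of_nat (j choose k) * (- f) ^ (j - k)))"
      using i j by (simp add: M_def U_def scalar_prod_def atLeast0LessThan)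
    also have "\<dots> = (\<Sum>k\<le>j. (D ^^ i) (f ^ (k + 1)) * (of_nat (j choose k) * (- f) ^ (j - k)))"
      using j by (intro sum.mono_neutral_right) (auto simp: not_le binomial_eq_0)
    \<comment> \<open>Taking \<open>h = f\<close> in the expansion turns \<open>f ^ k * h\<close>
      into the column power \<open>f ^ (k + 1)\<close>.\<close>
    also have "\<dots> = (ad f ^^ j) (D ^^ i) f"
      unfolding ad_funpow_expand by (simp add: ac_simps)
    finally show "(M * U) $$ (i, j) = T $$ (i, j)"
      using i j by (simp add: T_def)
  qed (simp_all add: M_def U_def T_def)
  then have "det M = det T"
    using det_mult[OF carrier(1,2)] \<open>det U = 1\<close> by simp
  also have "det T = prod_list (diag_mat T)"
    using carrier(3)
    by (intro det_lower_triangular[where n = n]) (auto simp: T_def ad_funpow_derivation_funpow[OF assms(1)])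
  also have "\<dots> = (\<Prod>j<n. of_nat (fact j) * D f ^ j * f)"
    by (simp add: prod_list_diag_prod T_def ad_funpow_derivation_funpow[OF assms(1)] atLeast0LessThan)
  also have "\<dots> = (\<Prod>j<n. of_nat (fact j)) * D f ^ (\<Sum>j<n. j) * f ^ n"
    by (simp add: prod.distrib power_sum)
  also have "(\<Sum>j<n. j) = n * (n - 1) div 2"
    using assms(2) Sum_Ico_nat[of 0 n] by (simp add: atLeast0LessThan)
  also have "(\<Prod>j<n. of_nat (fact j)) = (of_nat (\<Prod>k = 1..n - 1. fact k) :: 'a)"
  proof -
    \<comment> \<open>The factor at \<open>j = 0\<close> is \<open>fact 0 = 1\<close>, so the
      product may start at 1.\<close>
    obtain m where "n = Suc m" using assms(2) by (cases n) auto
    then show ?thesis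
      by (simp del: prod.lessThan_Suc fact_Suc add: prod.lessThan_Suc_shift prod.atLeast1_atMost_eq)
  qed
  finally show ?thesis by (simp only: M_def)
qed

end
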